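(* Let $M$ and $N$ be finitary matroids on the same countable edge set $E$. Then $\{M,N\}$ has the Intersection property, i.e. there exist a common independent set $I$ of $M$ and $N$ and a bipartition $E=E_M\cup E_N$ (with $E_M\cap E_N=\varnothing$) such that $I\cap E_M$ spans $E_M$ in $M$ and $I\cap E_N$ spans $E_N$ in $N$.
   Context: A finitary matroid on $E$ is a pair $(E,\mathcal I)$ with $\mathcal I\subseteq\mathcal P(E)$ such that: (i) $\varnothing\in\mathcal I$; (ii) $\mathcal I$ is downward closed; (iii) for all finite $I,J\in\mathcal I$ with $|J|=|I|+1$ there is $e\in J\setminus I$ with $I+e:=I\cup\{e\}\in\mathcal I$; (iv) if every finite subset of $X\subseteq E$ is in $\mathcal I$, then $X\in\mathcal I$. Members of $\mathcal I$ are called independent; circuits are the minimal dependent (non-independent) sets. A set $X$ spans $e$ in $M$ if $e\in X$ or there is a circuit $C\ni e$ with $C\setminus\{e\}\subseteq X$; $X$ spans a set if it spans each of its elements. *)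

theory Defs
  imports "HOL-Library.Countable_Set"
begin

locale finitary_matroid =
  fixes E :: "'a set" and \<I> :: "'a set set"
  assumes indep_carrier: "I \<in> \<I> \<Longrightarrow> I \<subseteq> E"
    and indep_empty: "{} \<in> \<I>"
    and indep_subset: "J \<in> \<I> \<Longrightarrow> I \<subseteq> J \<Longrightarrow> I \<in> \<I>"
    and indep_augment:
      "I \<in> \<I> \<Longrightarrow> J \<in> \<I> \<Longrightarrow> finite I \<Longrightarrow> finite J \<Longrightarrow> card J = card I + 1 \<Longrightarrow>
        \<exists>e \<in> J - I. insert e I \<in> \<I>"
    and indep_finitary:
      "X \<subseteq> E \<Longrightarrow> (\<And>F. F \<subseteq> X \<Longrightarrow> finite F \<Longrightarrow> F \<in> \<I>) \<Longrightarrow> X \<in> \<I>"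

text \<open>Circuits and spanning are defined for an arbitrary set system on \<open>E\<close>, so that
  two matroids on the same ground set can be used side by side.\<close>

definition dependent :: "'a set \<Rightarrow> 'a set set \<Rightarrow> 'a set \<Rightarrow> bool" where
  "dependent E \<I> X \<longleftrightarrow> X \<subseteq> E \<and> X \<notin> \<I>"

definition circuit :: "'a set \<Rightarrow> 'a set set \<Rightarrow> 'a set \<Rightarrow> bool" where
  "circuit E \<I> C \<longleftrightarrow> dependent E \<I> C \<and> (\<forall>D. D \<subset> C \<longrightarrow> \<not> dependent E \<I> D)"

definition spans_elem :: "'a set \<Rightarrow> 'a set set \<Rightarrow> 'a set \<Rightarrow> 'a \<Rightarrow> bool" where
  "spans_elem E \<I> X e \<longleftrightarrow> e \<in> X \<or> (\<exists>C. circuit E \<I> C \<and> e \<in> C \<and> C - {e} \<subseteq> X)"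

definition spans :: "'a set \<Rightarrow> 'a set set \<Rightarrow> 'a set \<Rightarrow> 'a set \<Rightarrow> bool" where
  "spans E \<I> X Y \<longleftrightarrow> (\<forall>e \<in> Y. spans_elem E \<I> X e)"

text \<open>Either part of the bipartition may be empty.\<close>

definition intersection_property :: "'a set \<Rightarrow> 'a set set \<Rightarrow> 'a set set \<Rightarrow> bool" where
  "intersection_property E \<M> \<N> \<longleftrightarrow>
    (\<exists>I E\<^sub>M E\<^sub>N. I \<in> \<M> \<and> I \<in> \<N> \<and> E = E\<^sub>M \<union> E\<^sub>N \<and> E\<^sub>M \<inter> E\<^sub>N = {} \<and>
      spans E \<M> (I \<inter> E\<^sub>M) E\<^sub>M \<and> spans E \<N> (I \<inter> E\<^sub>N) E\<^sub>N)"

end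

theory Submission
  imports Defs
begin

text \<open>A wave is a set \<open>W\<close> with an \<open>M\<close>-basis \<open>V\<close> of \<open>W\<close> that is independent in \<open>N/(E - W)\<close>. Splitting
  off a maximal wave as part of \<open>E\<^sub>M\<close>, one may assume that the pair is loose, i.e. has only trivial
  waves, and has to find an \<open>M\<close>-independent base of \<open>N\<close>. Augmenting along a shortest path in a
  contraction of the pair that is loose and absorbing a maximal wave afterwards makes it loose again,
  so by countability it is enough to \<open>N\<close>-span one given element \<open>x\<close> by a set whose contraction
  leaves the pair loose. Suppose this is impossible. Enumerate \<open>E\<close> and augment repeatedly so that
  for every \<open>k\<close> the rank of the first \<open>k\<close> elements over the current set eventually becomes as small
  as further augmentations permit. From then on no augmenting path starts in their span, and the set
  of vertices reachable from there is never touched again. The union of these sets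
  is a wave whose basis and complement do not \<open>N\<close>-span \<open>x\<close>, contradicting looseness. The current sets
  themselves need not converge outside this union, and this does no harm, because independence in \<open>N\<close>, unlike
  spanning, can be checked on finite sets.\<close>

section \<open>Matroids as closure operators\<close>

locale matroid_closure =
  fixes c :: "'a set \<Rightarrow> 'a set"
  assumes ext: "X \<subseteq> c X"
    and mono: "X \<subseteq> Y \<Longrightarrow> c X \<subseteq> c Y"
    and idem: "c (c X) \<subseteq> c X"
    and exchange: "y \<in> c (insert x X) \<Longrightarrow> y \<notin> c X \<Longrightarrow> x \<in> c (insert y X)"
    and finitary: "x \<in> c X \<Longrightarrow> \<exists>F. F \<subseteq> X \<and> finite F \<and> x \<in> c F"

definition indep :: "('a set \<Rightarrow> 'a set) \<Rightarrow> 'a set \<Rightarrow> bool" where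
  "indep c X \<longleftrightarrow> (\<forall>x\<in>X. x \<notin> c (X - {x}))"

text \<open>Both minors keep the whole type as ground set: contracted elements and, in
  \<open>del\<close> below, deleted elements become loops. So complements such as \<open>- W\<close>
  always make sense.\<close>

definition contr :: "('a set \<Rightarrow> 'a set) \<Rightarrow> 'a set \<Rightarrow> 'a set \<Rightarrow> 'a set" where
  "contr c A X = c (A \<union> X)"

definition del :: "('a set \<Rightarrow> 'a set) \<Rightarrow> 'a set \<Rightarrow> 'a set \<Rightarrow> 'a set" where
  "del c W X = c (X - W) \<union> W"

lemma indep_empty [simp]: "indep c {}"
  by (simp add: indep_def)

lemma contr_empty [simp]: "contr c {} = c"
  by (simp add: contr_def fun_eq_iff)

lemma contr_contr: "contr (contr c A) B = contr c (A \<union> B)"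
  by (simp add: contr_def fun_eq_iff Un_assoc)

context matroid_closure
begin

lemma span_subset: "X \<subseteq> c Y \<Longrightarrow> c X \<subseteq> c Y"
  using mono[of X "c Y"] idem[of Y] by blast

lemma monoD: "x \<in> c X \<Longrightarrow> X \<subseteq> Y \<Longrightarrow> x \<in> c Y"
  using mono by (rule subsetD)

lemma span_Un_cong: "c A = c B \<Longrightarrow> c (A \<union> X) = c (B \<union> X)"
proof -
  have *: "c (A \<union> X) \<subseteq> c (B \<union> X)" if "c A = c B" for A B
    using that ext[of A] mono[of B "B \<union> X"] ext[of "B \<union> X"] by (intro span_subset) blast
  then show "c A = c B \<Longrightarrow> ?thesis" by (simp add: subset_antisym)
qed

lemma contr_cong: "c A = c B \<Longrightarrow> contr c A = contr c B"
  unfolding contr_def fun_eq_iff by (intro allI span_Un_cong)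

lemma contr_closure: "matroid_closure (contr c A)"
proof (rule matroid_closure.intro; unfold contr_def)
  fix X Y :: "'a set" and x y :: 'a
  show "X \<subseteq> c (A \<union> X)" using ext by blast
  show "X \<subseteq> Y \<Longrightarrow> c (A \<union> X) \<subseteq> c (A \<union> Y)" by (intro mono) blast
  show "c (A \<union> c (A \<union> X)) \<subseteq> c (A \<union> X)" using ext[of "A \<union> X"] by (intro span_subset) blast
  show "y \<in> c (A \<union> insert x X) \<Longrightarrow> y \<notin> c (A \<union> X) \<Longrightarrow> x \<in> c (A \<union> insert y X)"
    using exchange[of y x "A \<union> X"] by simp
  assume "x \<in> c (A \<union> X)"
  from finitary[OF this] obtain F where F: "F \<subseteq> A \<union> X" "finite F" "x \<in> c F" by blast
  then have "x \<in> c (A \<union> (F \<inter> X))" using mono[of F "A \<union> (F \<inter> X)"] by blast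
  then show "\<exists>F. F \<subseteq> X \<and> finite F \<and> x \<in> c (A \<union> F)" using F by (intro exI[of _ "F \<inter> X"]) simp
qed

lemma del_closure: "matroid_closure (del c W)"
proof (rule matroid_closure.intro; unfold del_def)
  fix X Y :: "'a set" and x y :: 'a
  show "X \<subseteq> c (X - W) \<union> W" using ext[of "X - W"] by blast
  show "X \<subseteq> Y \<Longrightarrow> c (X - W) \<union> W \<subseteq> c (Y - W) \<union> W" using mono[of "X - W" "Y - W"] by blast
  show "c (c (X - W) \<union> W - W) \<union> W \<subseteq> c (X - W) \<union> W"
    using span_subset[of "c (X - W) \<union> W - W" "X - W"] by blast
  show "y \<in> c (insert x X - W) \<union> W \<Longrightarrow> y \<notin> c (X - W) \<union> W \<Longrightarrow> x \<in> c (insert y X - W) \<union> W"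
    using exchange[of y x "X - W"] by (cases "x \<in> W") (auto simp: insert_Diff_if)
  assume "x \<in> c (X - W) \<union> W"
  then show "\<exists>F. F \<subseteq> X \<and> finite F \<and> x \<in> c (F - W) \<union> W"
  proof
    assume "x \<in> c (X - W)"
    from finitary[OF this] obtain F where "F \<subseteq> X - W" "finite F" "x \<in> c F" by blast
    moreover from this have "F - W = F" by blast
    ultimately show ?thesis by (intro exI[of _ F]) auto
  qed auto
qed

section \<open>Independence and its finite character\<close>

lemma indep_mono: "indep c Y \<Longrightarrow> X \<subseteq> Y \<Longrightarrow> indep c X"
  unfolding indep_def by (meson monoD Diff_mono order_refl subsetD)

lemma indepD: "indep c X \<Longrightarrow> x \<in> X \<Longrightarrow> Y \<subseteq> X - {x} \<Longrightarrow> x \<notin> c Y"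
  unfolding indep_def by (meson monoD)

lemma indep_loops: "indep c X \<Longrightarrow> x \<in> X \<Longrightarrow> x \<notin> c {}"
  by (rule indepD) auto

lemma indep_insert:
  assumes "indep c X" "x \<notin> c X"
  shows "indep c (insert x X)"
  unfolding indep_def
proof
  fix y assume y: "y \<in> insert x X"
  show "y \<notin> c (insert x X - {y})"
  proof (cases "y = x")
    case True
    then show ?thesis using assms(2) mono[of "X - {x}" X] by auto
  next
    case False
    then have "y \<in> X" "insert x X - {y} = insert x (X - {y})" using y by auto
    then show ?thesis
      using assms exchange[of y x "X - {y}"] by (auto simp: indep_def insert_absorb)
  qed
qed

lemma indep_finite: "(\<And>F. F \<subseteq> X \<Longrightarrow> finite F \<Longrightarrow> indep c F) \<Longrightarrow> indep c X"
  unfolding indep_def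
proof
  fix x assume *: "\<And>F. F \<subseteq> X \<Longrightarrow> finite F \<Longrightarrow> \<forall>x\<in>F. x \<notin> c (F - {x})" and x: "x \<in> X"
  show "x \<notin> c (X - {x})"
  proof
    assume "x \<in> c (X - {x})"
    from finitary[OF this] obtain F where F: "F \<subseteq> X - {x}" "finite F" "x \<in> c F" by blast
    moreover have "insert x F - {x} = F" using F by auto
    ultimately show False using *[of "insert x F"] x by auto
  qed
qed

lemma indep_Union_chain:
  assumes "\<And>X. X \<in> \<C> \<Longrightarrow> indep c X"
    and "\<And>X Y. X \<in> \<C> \<Longrightarrow> Y \<in> \<C> \<Longrightarrow> X \<subseteq> Y \<or> Y \<subseteq> X"
  shows "indep c (\<Union>\<C>)"
proof (cases "\<C> = {}")
  case False
  show ?thesis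
  proof (rule indep_finite)
    fix F assume F: "F \<subseteq> \<Union>\<C>" "finite F"
    have "subset.chain \<C> \<C>" using assms(2) by (auto simp: subset.chain_def)
    then obtain X where "X \<in> \<C>" "F \<subseteq> X" using finite_subset_Union_chain[of F \<C> \<C>] F False by blast
    then show "indep c F" using assms(1) indep_mono by blast
  qed
qed simp

lemma indep_UN_mono:
  fixes f :: "nat \<Rightarrow> 'a set"
  assumes "\<And>n. indep c (f n)" "\<And>n. f n \<subseteq> f (Suc n)"
  shows "indep c (\<Union>n. f n)"
proof (rule indep_Union_chain)
  fix X Y assume "X \<in> range f" "Y \<in> range f"
  then obtain m n where "X = f m" "Y = f n" by blast
  then show "X \<subseteq> Y \<or> Y \<subseteq> X"
    using lift_Suc_mono_le[of f m n, OF assms(2)] lift_Suc_mono_le[of f n m, OF assms(2)]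
    by (meson linorder_le_cases)
qed (use assms in auto)

text \<open>The elements of a finite part of \<open>B\<close> can be added to \<open>A\<close> one
  at a time; finite character does the rest.\<close>

lemma indep_Un:
  assumes "indep c A" "indep (contr c A) B"
  shows "indep c (A \<union> B)"
proof (rule indep_finite)
  fix F assume F: "F \<subseteq> A \<union> B" "finite F"
  have "indep c (A \<union> B0)" if "finite B0" "B0 \<subseteq> B" for B0
    using that
  proof induct
    case (insert b B0)
    have "b \<notin> c (A \<union> (B - {b}))" using insert assms(2) by (auto simp: indep_def contr_def)
    then have "b \<notin> c (A \<union> B0)" using mono[of "A \<union> B0" "A \<union> (B - {b})"] insert by blast
    then show ?case using indep_insert insert by auto
  qed (use assms in simp)
  then have "indep c (A \<union> (F \<inter> B))" using F by auto
  then show "indep c F" by (rule indep_mono) (use F in blast)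
qed

lemma indep_contr_sub: "indep (contr c A) B \<Longrightarrow> A' \<subseteq> A \<Longrightarrow> indep (contr c A') B"
  unfolding indep_def contr_def by (meson monoD Un_mono order_refl)

lemma indep_contr_disjoint: "indep (contr c A) B \<Longrightarrow> B \<inter> c A = {}"
  unfolding indep_def contr_def by (metis disjoint_iff monoD Un_upper1)

section \<open>Fundamental circuits and exchange\<close>

text \<open>For \<open>x\<close> outside \<open>J\<close> the set is the fundamental circuit of
  \<open>x\<close> without \<open>x\<close>. If some \<open>f\<close> in a smallest spanning set
  \<open>F\<close> could be avoided, exchange would put \<open>f\<close> into the span of
  \<open>J - {f}\<close>.\<close>

lemma span_support:
  assumes J: "indep c J" and x: "x \<in> c J"
  shows "x \<in> c {f \<in> J. x \<notin> c (J - {f})}"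
proof -
  obtain F where "F \<subseteq> J \<and> finite F \<and> x \<in> c F" using finitary[OF x] by blast
  then obtain F where F: "F \<subseteq> J \<and> finite F \<and> x \<in> c F"
    and least: "\<And>G. G \<subseteq> J \<and> finite G \<and> x \<in> c G \<Longrightarrow> card F \<le> card G"
    using ex_has_least_nat[of "\<lambda>F. F \<subseteq> J \<and> finite F \<and> x \<in> c F" F card] by blast
  have "x \<notin> c (J - {f})" if f: "f \<in> F" for f
  proof
    assume *: "x \<in> c (J - {f})"
    have "x \<notin> c (F - {f})"
      using least[of "F - {f}"] F f by (metis Diff_subset card_Diff1_less finite_Diff leD order_trans)
    moreover have "x \<in> c (insert f (F - {f}))" using F f by (simp add: insert_absorb)
    ultimately have "f \<in> c (insert x (F - {f}))" by (rule exchange[rotated])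
    moreover have "insert x (F - {f}) \<subseteq> c (J - {f})" using * F ext[of "J - {f}"] by blast
    ultimately have "f \<in> c (J - {f})" by (meson span_subset subsetD)
    then show False using J F f by (auto simp: indep_def)
  qed
  then have "F \<subseteq> {f \<in> J. x \<notin> c (J - {f})}" using F by blast
  then show ?thesis using monoD F by meson
qed

text \<open>Every subset of \<open>J\<close> that spans \<open>x\<close> contains the fundamental
  circuit of \<open>x\<close>, hence so does the intersection of two of them.\<close>

lemma span_Int:
  assumes "indep c J" "A \<subseteq> J" "B \<subseteq> J" "x \<in> c A" "x \<in> c B"
  shows "x \<in> c (A \<inter> B)"
proof -
  have "{f \<in> J. x \<notin> c (J - {f})} \<subseteq> A \<inter> B"
  proof
    fix f assume "f \<in> {f \<in> J. x \<notin> c (J - {f})}"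
    then have "f \<in> J" "\<not> A \<subseteq> J - {f}" "\<not> B \<subseteq> J - {f}"
      using monoD[OF assms(4), of "J - {f}"] monoD[OF assms(5), of "J - {f}"] by auto
    then show "f \<in> A \<inter> B" using assms(2,3) by blast
  qed
  moreover have "x \<in> c J" using assms(2,4) monoD by meson
  ultimately show ?thesis using span_support[OF assms(1)] monoD by meson
qed

lemma span_INT:
  assumes "indep c J" "x \<in> c J" "\<And>f. f \<in> F \<Longrightarrow> x \<in> c (J - {f})"
  shows "x \<in> c (J - F)"
proof -
  have "{f \<in> J. x \<notin> c (J - {f})} \<subseteq> J - F" using assms(3) by blast
  then show ?thesis using span_support[OF assms(1,2)] monoD by meson
qed

lemma exchange_one:
  assumes "indep c J" "f \<in> J" "z \<in> c J" "z \<notin> c (J - {f})"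
  shows "indep c (insert z (J - {f}))" "c (insert z (J - {f})) = c J"
proof -
  show "indep c (insert z (J - {f}))" using assms(1,4) indep_insert indep_mono by (meson Diff_subset)
  have "f \<in> c (insert z (J - {f}))"
    using exchange[of z f "J - {f}"] assms by (simp add: insert_absorb)
  then have "J \<subseteq> c (insert z (J - {f}))" using ext[of "insert z (J - {f})"] by blast
  moreover have "insert z (J - {f}) \<subseteq> c J" using assms ext by blast
  ultimately show "c (insert z (J - {f})) = c J" by (meson span_subset subset_antisym)
qed

text \<open>The fundamental circuit of \<open>z i\<close> contains \<open>f i\<close>, and that of a
  later \<open>z j\<close> avoids it. When exchanging in the order of the indices,
  \<open>z n\<close> therefore still needs \<open>f n\<close> when its turn comes.\<close>

lemma exchange_triangular:
  fixes f z :: "nat \<Rightarrow> 'a"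
  assumes J: "indep c J"
    and "\<And>i. i < n \<Longrightarrow> f i \<in> J" "\<And>i. i < n \<Longrightarrow> z i \<in> c J"
    and "\<And>i. i < n \<Longrightarrow> z i \<notin> c (J - {f i})"
    and "\<And>i j. i < j \<Longrightarrow> j < n \<Longrightarrow> z j \<in> c (J - {f i})"
  shows "indep c ((J - f ` {..<n}) \<union> z ` {..<n}) \<and> c ((J - f ` {..<n}) \<union> z ` {..<n}) = c J"
  using assms(2-)
proof (induct n)
  case (Suc n)
  let ?K = "(J - f ` {..<n}) \<union> z ` {..<n}"
  have K: "indep c ?K" "c ?K = c J" using Suc by auto
  have distinct: "f n \<notin> f ` {..<n}"
    using Suc.prems(3)[of n] Suc.prems(4)[of _ n] by (metis imageE lessI lessThan_iff)
  \<comment> \<open>Removing \<open>f n\<close> must not remove an element inserted earlier.\<close>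
  have fz: "f n \<notin> z ` {..<n}"
  proof
    assume "f n \<in> z ` {..<n}"
    then obtain i where i: "i < n" "f n = z i" by blast
    moreover have "f n \<in> c (J - {f i})" if "f n \<noteq> f i"
      using that Suc.prems(1)[of n] ext[of "J - {f i}"] by blast
    ultimately show False using distinct Suc.prems(3)[of i] by (metis imageI less_SucI lessThan_iff)
  qed
  have fK: "f n \<in> ?K" using distinct Suc.prems(1)[of n] by auto
  have "z n \<in> c (J - f ` {..<n})"
  proof (rule span_INT[OF J])
    show "z n \<in> c J" using Suc.prems by simp
    show "z n \<in> c (J - {g})" if "g \<in> f ` {..<n}" for g using that Suc.prems(4) by auto
  qed
  \<comment> \<open>\<open>J\<close> without the earlier \<open>f i\<close> spans \<open>z n\<close>
    and survives inside \<open>?K\<close>. A second spanning set that avoids \<open>f n\<close>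
    would meet it in a subset of \<open>J - {f n}\<close>.\<close>
  then have "z n \<in> c ((J - f ` {..<n}) \<inter> (?K - {f n}))" if "z n \<in> c (?K - {f n})"
    by (rule span_Int[OF K(1), rotated 2]) (use that in auto)
  then have "z n \<notin> c (?K - {f n})"
    using mono[of "(J - f ` {..<n}) \<inter> (?K - {f n})" "J - {f n}"] Suc.prems(3)[of n] by blast
  then have "indep c (insert (z n) (?K - {f n}))" "c (insert (z n) (?K - {f n})) = c J"
    using exchange_one[OF K(1) fK] Suc.prems(2)[of n] K(2) by auto
  moreover have "insert (z n) (?K - {f n}) = (J - f ` {..<Suc n}) \<union> z ` {..<Suc n}"
    using fz by (auto simp: lessThan_Suc)
  ultimately show ?case by simp
qed (use J in simp)

section \<open>Relative rank of finite sets\<close>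

text \<open>This is the rank of \<open>Q\<close> in the contraction by \<open>J\<close>. For finite
  \<open>Q\<close> the minimum exists, as \<open>Q\<close> itself is a candidate for
  \<open>R\<close>.\<close>

definition rank_over :: "'a set \<Rightarrow> 'a set \<Rightarrow> nat" where
  "rank_over J Q = (LEAST n. \<exists>R\<subseteq>Q. finite R \<and> card R = n \<and> Q \<subseteq> c (J \<union> R))"

lemma rank_over_witness:
  assumes "finite Q"
  obtains R where "R \<subseteq> Q" "finite R" "card R = rank_over J Q" "Q \<subseteq> c (J \<union> R)"
proof -
  have "Q \<subseteq> c (J \<union> Q)" using ext[of "J \<union> Q"] by blast
  then have "\<exists>n. \<exists>R\<subseteq>Q. finite R \<and> card R = n \<and> Q \<subseteq> c (J \<union> R)" using assms by blast
  from LeastI_ex[OF this] show ?thesis using that unfolding rank_over_def by blast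
qed

lemma rank_over_le: "R \<subseteq> Q \<Longrightarrow> finite R \<Longrightarrow> Q \<subseteq> c (J \<union> R) \<Longrightarrow> rank_over J Q \<le> card R"
  unfolding rank_over_def by (rule Least_le) blast

lemma span_Un_mono: "c J \<subseteq> c J' \<Longrightarrow> R \<subseteq> R' \<Longrightarrow> c (J \<union> R) \<subseteq> c (J' \<union> R')"
  using ext[of J] ext[of "J' \<union> R'"] mono[of J' "J' \<union> R'"] by (intro span_subset) blast

lemma rank_over_mono:
  assumes "finite Q" "c J \<subseteq> c J'"
  shows "rank_over J' Q \<le> rank_over J Q"
proof -
  obtain R where R: "R \<subseteq> Q" "finite R" "card R = rank_over J Q" "Q \<subseteq> c (J \<union> R)"
    using rank_over_witness assms(1) by blast
  then have "Q \<subseteq> c (J' \<union> R)" using span_Un_mono[OF assms(2), of R R] by blast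
  then show ?thesis using rank_over_le R by metis
qed

text \<open>A set \<open>R\<close> spanning \<open>Q\<close> over \<open>J\<close> can trade one
  element \<open>q\<close> for \<open>s\<close>. Since \<open>J'\<close> already spans
  \<open>s\<close>, \<open>R - {q}\<close> suffices over \<open>J'\<close>.\<close>

lemma rank_over_less:
  assumes Q: "finite Q" and le: "c J \<subseteq> c J'"
    and s: "s \<in> c (J \<union> Q)" "s \<notin> c J" "s \<in> c J'"
  shows "rank_over J' Q < rank_over J Q"
proof -
  obtain R where R: "R \<subseteq> Q" "finite R" "card R = rank_over J Q" "Q \<subseteq> c (J \<union> R)"
    using rank_over_witness Q by blast
  have "J \<union> Q \<subseteq> c (J \<union> R)" using R(4) ext[of "J \<union> R"] by blast
  then have "s \<in> c (J \<union> R)" using s(1) span_subset by blast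
  with R(2) have "\<exists>q\<in>R. q \<in> c (insert s (J \<union> (R - {q})))"
  proof (induct rule: finite_psubset_induct)
    case (psubset R)
    \<comment> \<open>Elements of \<open>R\<close> are dropped as long as \<open>s\<close> stays
      spanned; the first one that cannot be dropped is exchanged for \<open>s\<close>.\<close>
    obtain q where q: "q \<in> R" using psubset.prems s(2) by fastforce
    show ?case
    proof (cases "s \<in> c (J \<union> (R - {q}))")
      case True
      then obtain p where p: "p \<in> R - {q}" "p \<in> c (insert s (J \<union> (R - {q} - {p})))"
        using psubset.hyps(2)[of "R - {q}"] q by blast
      then have "p \<in> c (insert s (J \<union> (R - {p})))" by (elim monoD) auto
      then show ?thesis using p by blast
    next
      case False
      moreover have "insert q (J \<union> (R - {q})) = J \<union> R" using q by auto
      ultimately show ?thesis using exchange[of s q "J \<union> (R - {q})"] psubset.prems q by auto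
    qed
  qed
  then obtain q where q: "q \<in> R" "q \<in> c (insert s (J \<union> (R - {q})))" by blast
  have "insert s (J \<union> (R - {q})) \<subseteq> c (J' \<union> (R - {q}))"
    using s(3) le ext[of J] ext[of "J' \<union> (R - {q})"] mono[of J' "J' \<union> (R - {q})"] by blast
  then have "q \<in> c (J' \<union> (R - {q}))" using q(2) span_subset by blast
  then have "J \<union> R \<subseteq> c (J' \<union> (R - {q}))"
    using le ext[of J] ext[of "J' \<union> (R - {q})"] mono[of J' "J' \<union> (R - {q})"] by blast
  then have "Q \<subseteq> c (J' \<union> (R - {q}))" using R(4) span_subset by blast
  then have "rank_over J' Q \<le> card (R - {q})" using R by (intro rank_over_le) auto
  also have "\<dots> < card R" by (rule card_Diff1_less[OF R(2) q(1)])
  finally show ?thesis using R(3) by simp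
qed

end

section \<open>Waves\<close>

definition wave :: "('a set \<Rightarrow> 'a set) \<Rightarrow> ('a set \<Rightarrow> 'a set) \<Rightarrow> 'a set \<Rightarrow> 'a set \<Rightarrow> bool" where
  "wave c d W V \<longleftrightarrow> V \<subseteq> W \<and> indep c V \<and> W \<subseteq> c V \<and> indep (contr d (- W)) V"

text \<open>A wave violating the inclusion is a hindrance: its \<open>V\<close> is not a base of
  \<open>W\<close> in \<open>d\<close> contracted by \<open>- W\<close>.\<close>

definition unhindered :: "('a set \<Rightarrow> 'a set) \<Rightarrow> ('a set \<Rightarrow> 'a set) \<Rightarrow> bool" where
  "unhindered c d \<longleftrightarrow> (\<forall>W V. wave c d W V \<longrightarrow> W \<subseteq> d (- W \<union> V))"

text \<open>In such a trivial wave \<open>V\<close> is empty, being an independent set of loops of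
  \<open>c\<close>. A loose pair is in particular unhindered.\<close>

definition loose :: "('a set \<Rightarrow> 'a set) \<Rightarrow> ('a set \<Rightarrow> 'a set) \<Rightarrow> bool" where
  "loose c d \<longleftrightarrow> (\<forall>W V. wave c d W V \<longrightarrow> W \<subseteq> c {} \<and> W \<subseteq> d (- W))"

text \<open>An arc of the exchange digraph from \<open>y\<close> to \<open>x\<close> through an element \<open>f\<close> of \<open>J\<close>: \<open>f\<close> lies on
  the fundamental \<open>c\<close>-circuit of \<open>y\<close> (or \<open>y\<close> is not \<open>c\<close>-spanned by \<open>J\<close>) and on the fundamental
  \<open>d\<close>-circuit of \<open>x\<close>. Taking \<open>x = f\<close> or \<open>y = f\<close> gives the two halves of the arc.\<close>

definition link :: "('a set \<Rightarrow> 'a set) \<Rightarrow> ('a set \<Rightarrow> 'a set) \<Rightarrow> 'a set \<Rightarrow> 'a \<Rightarrow> 'a \<Rightarrow> bool" where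
  "link c d J y x \<longleftrightarrow> (\<exists>f\<in>J. y \<notin> c (J - {f}) \<and> x \<in> d J \<and> x \<notin> d (J - {f}))"

definition reach :: "('a set \<Rightarrow> 'a set) \<Rightarrow> ('a set \<Rightarrow> 'a set) \<Rightarrow> 'a set \<Rightarrow> 'a set \<Rightarrow> 'a set" where
  "reach c d J S = {x. \<exists>s\<in>S. (link c d J)\<^sup>*\<^sup>* s x}"

text \<open>No augmenting path can enter such a set: it could not leave again, but has to end
  outside \<open>c J\<close>.\<close>

definition blocked :: "('a set \<Rightarrow> 'a set) \<Rightarrow> ('a set \<Rightarrow> 'a set) \<Rightarrow> 'a set \<Rightarrow> 'a set \<Rightarrow> bool" where
  "blocked c d J B \<longleftrightarrow> B \<subseteq> c J \<and> (\<forall>y\<in>B. \<forall>x. link c d J y x \<longrightarrow> x \<in> B)"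

text \<open>The last clause says that passing from \<open>J\<close> to \<open>J'\<close> changes neither \<open>J\<close> inside a blocked set nor
  the arcs leaving it, so that sets of reachable elements can only grow.\<close>

definition refines :: "('a set \<Rightarrow> 'a set) \<Rightarrow> ('a set \<Rightarrow> 'a set) \<Rightarrow> 'a set \<Rightarrow> 'a set \<Rightarrow> bool" where
  "refines c d J J' \<longleftrightarrow> indep c J' \<and> indep d J' \<and> c J \<subseteq> c J' \<and> d J \<subseteq> d J' \<and>
    (\<forall>B. blocked c d J B \<longrightarrow>
      J' \<inter> B = J \<inter> B \<and> (\<forall>f\<in>J \<inter> B. d J \<inter> d (J' - {f}) \<subseteq> d (J - {f})))"

locale matroid_closure_pair = c: matroid_closure c + d: matroid_closure d
  for c d :: "'a set \<Rightarrow> 'a set"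
begin

text \<open>Zorn's lemma for the componentwise order. The union of a chain is a wave, as
  independence has finite character and a larger \<open>W\<close> only shrinks the contracted set
  \<open>- W\<close>.\<close>

lemma maximal_wave:
  obtains W V where "wave c d W V"
    and "\<And>W' V'. wave c d W' V' \<Longrightarrow> W \<subseteq> W' \<Longrightarrow> V \<subseteq> V' \<Longrightarrow> W' = W \<and> V' = V"
proof -
  \<comment> \<open>Pairs become subsets of a disjoint sum, because \<open>subset_Zorn\<close> works
    with plain inclusion.\<close>
  define enc :: "'a set \<times> 'a set \<Rightarrow> ('a + 'a) set" where "enc p = fst p <+> snd p" for p
  define \<W> where "\<W> = enc ` {(W, V). wave c d W V}"
  have enc_sub: "enc (W, V) \<subseteq> enc (W', V') \<longleftrightarrow> W \<subseteq> W' \<and> V \<subseteq> V'" for W V W' V'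
    by (auto simp: enc_def)
  have "\<exists>M\<in>\<W>. \<forall>X\<in>\<W>. M \<subseteq> X \<longrightarrow> X = M"
  proof (rule subset_Zorn)
    fix C assume C: "subset.chain \<W> C"
    define \<P> where "\<P> = {(W, V). wave c d W V \<and> enc (W, V) \<in> C}"
    define W where "W = \<Union>(fst ` \<P>)"
    define V where "V = \<Union>(snd ` \<P>)"
    have chain: "enc p \<subseteq> enc q \<or> enc q \<subseteq> enc p" if "p \<in> \<P>" "q \<in> \<P>" for p q
      using C that unfolding subset.chain_def \<P>_def by auto
    have V_chain: "X \<subseteq> Y \<or> Y \<subseteq> X" if XY: "X \<in> snd ` \<P>" "Y \<in> snd ` \<P>" for X Y
    proof -
      obtain p q where pq: "p \<in> \<P>" "q \<in> \<P>" "X = snd p" "Y = snd q" using XY by blast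
      have "snd p \<subseteq> snd q" if "enc p \<subseteq> enc q" for p q
        using that enc_sub[of "fst p" "snd p" "fst q" "snd q"] by simp
      then show ?thesis using chain[OF pq(1,2)] pq(3,4) by blast
    qed
    have pW: "fst p \<subseteq> W" "snd p \<subseteq> V" "wave c d (fst p) (snd p)" if "p \<in> \<P>" for p
      using that by (auto simp: W_def V_def \<P>_def)
    have "wave c d W V"
      unfolding wave_def
    proof (intro conjI)
      show "V \<subseteq> W" using pW by (force simp: V_def W_def wave_def)
      show "indep c V" unfolding V_def
        by (rule c.indep_Union_chain) (use pW V_chain in \<open>auto simp: wave_def\<close>)
      show "W \<subseteq> c V"
      proof
        fix x assume "x \<in> W"
        then obtain p where p: "p \<in> \<P>" "x \<in> fst p" by (auto simp: W_def)
        then have "x \<in> c (snd p)" using pW[OF p(1)] by (auto simp: wave_def)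
        then show "x \<in> c V" using c.monoD pW[OF p(1)] by meson
      qed
      interpret e: matroid_closure "contr d (- W)" by (rule d.contr_closure)
      show "indep (contr d (- W)) V" unfolding V_def
      proof (rule e.indep_Union_chain)
        fix X assume "X \<in> snd ` \<P>"
        then obtain p where p: "p \<in> \<P>" "X = snd p" by blast
        then show "indep (contr d (- W)) X"
          using pW[OF p(1)] d.indep_contr_sub[of "- fst p" X "- W"] by (auto simp: wave_def)
      qed (use V_chain in auto)
    qed
    then have "enc (W, V) \<in> \<W>" by (auto simp: \<W>_def)
    moreover have "X \<subseteq> enc (W, V)" if "X \<in> C" for X
    proof -
      have "X \<in> \<W>" using C that by (auto simp: subset.chain_def)
      then obtain W' V' where X: "X = enc (W', V')" "wave c d W' V'" by (auto simp: \<W>_def)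
      then have "(W', V') \<in> \<P>" using that by (simp add: \<P>_def)
      with X show ?thesis using pW[of "(W', V')"] enc_sub by simp
    qed
    ultimately show "\<exists>U\<in>\<W>. \<forall>X\<in>C. X \<subseteq> U" by blast
  qed
  then obtain W V where WV: "wave c d W V" "\<forall>X\<in>\<W>. enc (W, V) \<subseteq> X \<longrightarrow> X = enc (W, V)"
    by (auto simp: \<W>_def)
  show ?thesis
  proof (rule that[OF WV(1)])
    fix W' V' assume "wave c d W' V'" "W \<subseteq> W'" "V \<subseteq> V'"
    then have "enc (W', V') = enc (W, V)" using WV(2) enc_sub by (auto simp: \<W>_def)
    then show "W' = W \<and> V' = V" using enc_sub[of W' V' W V] enc_sub[of W V W' V'] by blast
  qed
qed

text \<open>The two bases are put together in opposite orders: in \<open>c\<close>,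
  \<open>V'\<close> is added after \<open>V\<close>; in \<open>d\<close>, \<open>V\<close> is added
  after \<open>V'\<close>, which lies in \<open>- W\<close>.\<close>

lemma wave_extend:
  assumes W: "wave c d W V"
    and V': "V' \<subseteq> W'" "indep (contr c V) V'" "W' \<subseteq> c (V \<union> V')"
      "indep (contr d (- (W \<union> W'))) V'"
  shows "wave c d (W \<union> W') (V \<union> V')"
proof -
  have "V' \<inter> c V = {}" using V' c.indep_contr_disjoint by blast
  then have disj: "V' \<inter> W = {}" using W by (auto simp: wave_def)
  interpret e: matroid_closure "contr d (- (W \<union> W'))" by (rule d.contr_closure)
  have "indep (contr (contr d (- (W \<union> W'))) V') V"
    unfolding contr_contr by (rule d.indep_contr_sub[of "- W"]) (use W disj in \<open>auto simp: wave_def\<close>)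
  then have "indep (contr d (- (W \<union> W'))) (V' \<union> V)" using e.indep_Un V'(4) by blast
  moreover have "indep c (V \<union> V')" using c.indep_Un W V'(2) by (auto simp: wave_def)
  moreover have "W \<subseteq> c (V \<union> V')" using W c.mono[of V "V \<union> V'"] by (auto simp: wave_def)
  ultimately show ?thesis using V' W by (auto simp: wave_def Un_commute)
qed

text \<open>Take \<open>V\<close> from a maximal wave \<open>W\<close>. A wave remaining after
  contraction of \<open>V\<close> would extend it and so lies in \<open>W\<close>, whose elements
  \<open>V\<close> spans in \<open>c\<close> and, by unhinderedness, \<open>V\<close> and
  \<open>- W\<close> span in \<open>d\<close>.\<close>

lemma unhindered_imp_loose_contr:
  assumes "unhindered c d"
  obtains V where "indep c V" "indep d V" "loose (contr c V) (contr d V)"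
proof -
  obtain W V where W: "wave c d W V"
    and max: "\<And>W' V'. wave c d W' V' \<Longrightarrow> W \<subseteq> W' \<Longrightarrow> V \<subseteq> V' \<Longrightarrow> W' = W \<and> V' = V"
    using maximal_wave by blast
  have "indep d V" using W d.indep_contr_sub[of "- W" V "{}"] by (simp add: wave_def)
  moreover have "loose (contr c V) (contr d V)"
    unfolding loose_def
  proof (intro allI impI)
    fix W' V' assume W': "wave (contr c V) (contr d V) W' V'"
    have "wave c d (W \<union> W') (V \<union> V')"
    proof (rule wave_extend[OF W])
      show "indep (contr d (- (W \<union> W'))) V'"
        using W' d.indep_contr_sub[of "V \<union> - W'" V' "- (W \<union> W')"] by (auto simp: wave_def contr_contr)
    qed (use W' in \<open>auto simp: wave_def contr_def\<close>)
    then have "W' \<subseteq> W" using max[of "W \<union> W'" "V \<union> V'"] by blast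
    moreover have "W \<subseteq> c V" using W by (simp add: wave_def)
    moreover have "W \<subseteq> d (- W \<union> V)" using assms W by (auto simp: unhindered_def)
    moreover have "d (- W \<union> V) \<subseteq> d (V \<union> - W')" using \<open>W' \<subseteq> W\<close> by (intro d.mono) blast
    ultimately show "W' \<subseteq> contr c V {} \<and> W' \<subseteq> contr d V (- W')" by (auto simp: contr_def)
  qed
  ultimately show ?thesis using that W by (auto simp: wave_def)
qed

section \<open>Augmentation\<close>

text \<open>Arcs lead from \<open>y\<close> to the members of its \<open>c\<close>-circuit in
  \<open>J\<close>, and from \<open>f\<close> in \<open>J\<close> to the elements whose
  \<open>d\<close>-circuit contains \<open>f\<close>. As no arc leaves \<open>B\<close>,
  \<open>c\<close>-circuits of elements of \<open>B\<close> stay inside and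
  \<open>d\<close>-circuits of elements outside stay outside.\<close>

lemma blocked_spans:
  assumes "indep c J" "indep d J" "blocked c d J B"
  shows "B \<subseteq> c (J \<inter> B)" "d J - B \<subseteq> d (J - B)"
proof -
  show "B \<subseteq> c (J \<inter> B)"
  proof
    fix y assume y: "y \<in> B"
    then have "y \<in> c {f \<in> J. y \<notin> c (J - {f})}"
      using assms(3) by (intro c.span_support assms) (auto simp: blocked_def)
    moreover have "{f \<in> J. y \<notin> c (J - {f})} \<subseteq> J \<inter> B"
    proof clarsimp
      fix f assume f: "f \<in> J" "y \<notin> c (J - {f})"
      then have "link c d J y f"
        using d.ext[of J] assms(2) by (auto simp: link_def indep_def intro!: bexI[of _ f])
      then show "f \<in> B" using assms(3) y by (auto simp: blocked_def)
    qed
    ultimately show "y \<in> c (J \<inter> B)" by (rule c.monoD)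
  qed
  show "d J - B \<subseteq> d (J - B)"
  proof
    fix x assume x: "x \<in> d J - B"
    show "x \<in> d (J - B)"
    proof (rule d.monoD)
      show "x \<in> d {f \<in> J. x \<notin> d (J - {f})}" using x by (intro d.span_support assms) auto
      have "f \<notin> B" if "f \<in> J" "x \<notin> d (J - {f})" for f
      proof
        assume "f \<in> B"
        moreover have "link c d J f x"
          using that x assms(1) by (auto simp: link_def indep_def intro!: bexI[of _ f])
        ultimately show False using assms(3) x by (auto simp: blocked_def)
      qed
      then show "{f \<in> J. x \<notin> d (J - {f})} \<subseteq> J - B" by blast
    qed
  qed
qed

lemma blocked_reach: "reach c d J S \<subseteq> c J \<Longrightarrow> blocked c d J (reach c d J S)"
  unfolding blocked_def reach_def by (blast intro: rtranclp.rtrancl_into_rtrancl)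

lemma subset_reach: "S \<subseteq> reach c d J S"
  by (auto simp: reach_def)

text \<open>New elements are not \<open>c\<close>-spanned by \<open>J1\<close>, whereas blocked sets
  are. For the arcs, \<open>span_Int\<close> reduces \<open>J2 - {f}\<close> to
  \<open>J1 - {f}\<close>.\<close>

lemma refines_extend:
  assumes J: "refines c d J J1" and sub: "J1 \<subseteq> J2" "indep c J2" "indep d J2"
  shows "refines c d J J2"
proof -
  have spans: "c J1 \<subseteq> c J2" "d J1 \<subseteq> d J2" using sub c.mono d.mono by auto
  have "J2 \<inter> B = J \<inter> B \<and> (\<forall>f\<in>J \<inter> B. d J \<inter> d (J2 - {f}) \<subseteq> d (J - {f}))"
    if B: "blocked c d J B" for B
  proof (intro conjI ballI)
    have J1: "J1 \<inter> B = J \<inter> B" "\<And>f. f \<in> J \<inter> B \<Longrightarrow> d J \<inter> d (J1 - {f}) \<subseteq> d (J - {f})"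
      using J B by (auto simp: refines_def)
    have "x \<in> J1" if "x \<in> J2" "x \<in> B" for x
    proof (rule ccontr)
      assume "x \<notin> J1"
      then have "x \<notin> c J1" using c.indepD[OF sub(2) that(1)] sub(1) by blast
      then show False using that(2) B J by (auto simp: blocked_def refines_def)
    qed
    then show "J2 \<inter> B = J \<inter> B" using J1(1) sub(1) by blast
    fix f assume f: "f \<in> J \<inter> B"
    show "d J \<inter> d (J2 - {f}) \<subseteq> d (J - {f})"
    proof
      fix x assume x: "x \<in> d J \<inter> d (J2 - {f})"
      then have "x \<in> d J1" using J by (auto simp: refines_def)
      then have "x \<in> d (J1 \<inter> (J2 - {f}))" using x sub by (intro d.span_Int[OF sub(3)]) auto
      moreover have "J1 \<inter> (J2 - {f}) = J1 - {f}" using sub(1) by blast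
      ultimately show "x \<in> d (J - {f})" using x J1(2)[OF f] by auto
    qed
  qed
  then show ?thesis using J sub spans by (auto simp: refines_def)
qed

text \<open>Paths survive arc by arc: the \<open>c\<close>-circuits involved lie in the blocked set,
  where \<open>J\<close> is unchanged, and the \<open>d\<close>-side is the last clause of
  \<open>refines\<close>.\<close>

lemma reach_mono_refines:
  assumes J: "indep c J" "indep d J" and R: "reach c d J S \<subseteq> c J"
    and J': "refines c d J J'" and S: "S \<subseteq> S'"
  shows "reach c d J S \<subseteq> reach c d J' S'" "J' \<inter> reach c d J S = J \<inter> reach c d J S"
proof -
  let ?B = "reach c d J S"
  have B: "blocked c d J ?B" using R by (rule blocked_reach)
  show eq: "J' \<inter> ?B = J \<inter> ?B" using J' B by (auto simp: refines_def)
  show "?B \<subseteq> reach c d J' S'"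
  proof
    fix x assume "x \<in> ?B"
    then obtain s where s: "s \<in> S" "(link c d J)\<^sup>*\<^sup>* s x" by (auto simp: reach_def)
    from s(2) have "x \<in> ?B \<and> x \<in> reach c d J' S'"
    proof (induct rule: rtranclp_induct)
      case base
      then show ?case using s(1) S by (auto simp: reach_def)
    next
      case (step y x)
      then have y: "y \<in> ?B" "y \<in> reach c d J' S'" by auto
      then have x: "x \<in> ?B" using B step(2) by (auto simp: blocked_def)
      obtain f where f: "f \<in> J" "y \<notin> c (J - {f})" "x \<in> d J" "x \<notin> d (J - {f})"
        using step(2) by (auto simp: link_def)
      then have "link c d J y f"
        using d.ext[of J] J(2) by (auto simp: link_def indep_def intro!: bexI[of _ f])
      then have fB: "f \<in> J \<inter> ?B" using B y f by (auto simp: blocked_def)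
      have "y \<notin> c (J' - {f})"
      proof
        assume y1: "y \<in> c (J' - {f})"
        have y2: "y \<in> c (J' \<inter> ?B)" using blocked_spans(1)[OF J B] y eq by auto
        have "indep c J'" using J' by (simp add: refines_def)
        from c.span_Int[OF this Diff_subset Int_lower1 y1 y2]
        have "y \<in> c ((J' - {f}) \<inter> (J' \<inter> ?B))" .
        then have "y \<in> c (J - {f})" by (rule c.monoD) (use eq in blast)
        then show False using f by blast
      qed
      moreover have "x \<in> d J'" using J' f by (auto simp: refines_def)
      moreover have "x \<notin> d (J' - {f})"
      proof -
        have "d J \<inter> d (J' - {f}) \<subseteq> d (J - {f})" using J' B fB unfolding refines_def by blast
        then show ?thesis using f by blast
      qed
      moreover have "f \<in> J'" using eq fB by blast
      ultimately have "link c d J' y x" by (auto simp: link_def)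
      then show ?case using x y by (auto simp: reach_def intro: rtranclp.rtrancl_into_rtrancl)
    qed
    then show "x \<in> reach c d J' S'" by blast
  qed
qed

text \<open>A shortest path from \<open>S\<close> to an element outside \<open>c J\<close> has no
  shortcuts, which makes the exchanges along it triangular in both matroids.\<close>

lemma augment:
  assumes J: "indep c J" "indep d J" and S: "S \<inter> d J = {}" and R: "\<not> reach c d J S \<subseteq> c J"
  obtains s g J' where "s \<in> S" "g \<notin> c J" "refines c d J J'"
    "c J' = c (insert g J)" "d J' = d (insert s J)"
proof -
  let ?L = "link c d J"
  define hit where "hit n \<longleftrightarrow> (\<exists>s\<in>S. \<exists>g. (?L ^^ n) s g \<and> g \<notin> c J)" for n
  have "\<exists>n. hit n" using R by (auto simp: reach_def hit_def rtranclp_power)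
  then obtain n where n: "hit n" and minimal: "\<And>m. m < n \<Longrightarrow> \<not> hit m"
    using exists_least_iff[of hit] by blast
  then obtain s g where sg: "s \<in> S" "(?L ^^ n) s g" "g \<notin> c J" by (auto simp: hit_def)
  then obtain x where x: "x 0 = s" "x n = g" and link: "\<And>i. i < n \<Longrightarrow> ?L (x i) (x (Suc i))"
    by (auto simp: relpowp_fun_conv)
  have path: "(?L ^^ (j - i)) (x i) (x j)" if "i \<le> j" "j \<le> n" for i j
    unfolding relpowp_fun_conv using that link by (intro exI[of _ "\<lambda>k. x (i + k)"]) auto
  have no_shortcut: "\<not> ?L (x i) (x (Suc j))" if "i < j" "j < n" for i j
  proof
    assume "?L (x i) (x (Suc j))"
    moreover have "(?L ^^ i) s (x i)" "(?L ^^ (n - Suc j)) (x (Suc j)) g"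
      using path[of 0 i] path[of "Suc j" n] that x by auto
    ultimately have "(?L ^^ (Suc i + (n - Suc j))) s g"
      by (metis relpowp_Suc_I relpowp_add relcompp.relcompI)
    then have "hit (Suc i + (n - Suc j))" using sg by (auto simp: hit_def)
    moreover have "Suc i + (n - Suc j) < n" using that by simp
    ultimately show False using minimal by blast
  qed
  have xc: "x i \<in> c J" if "i < n" for i
  proof (rule ccontr)
    assume "x i \<notin> c J"
    then have "hit i" using path[of 0 i] that x sg(1) by (auto simp: hit_def)
    then show False using minimal that by blast
  qed
  obtain f where f: "\<And>i. i < n \<Longrightarrow> f i \<in> J \<and> x i \<notin> c (J - {f i}) \<and> x (Suc i) \<in> d J \<and> x (Suc i) \<notin> d (J - {f i})"
    using link unfolding link_def by metis
  \<comment> \<open>A violation here or in \<open>chord_d\<close> would be an arc from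
    \<open>x i\<close> to \<open>x (Suc j)\<close>.\<close>
  have chord_c: "x i \<in> c (J - {f j})" if "i < j" "j < n" for i j
  proof (rule ccontr)
    assume "x i \<notin> c (J - {f j})"
    then have "?L (x i) (x (Suc j))" using f[OF that(2)] by (auto simp: link_def)
    then show False using no_shortcut that by blast
  qed
  have chord_d: "x (Suc j) \<in> d (J - {f i})" if "i < j" "j < n" for i j
  proof (rule ccontr)
    assume "x (Suc j) \<notin> d (J - {f i})"
    then have "?L (x i) (x (Suc j))" using f[of i] f[of j] that by (auto simp: link_def)
    then show False using no_shortcut that by blast
  qed

  \<comment> \<open>In \<open>c\<close> the elements \<open>x 0\<close>, ...,
    \<open>x (n - 1)\<close> replace the \<open>f i\<close> and \<open>x n\<close> is added; in
    \<open>d\<close> the elements \<open>x 1\<close>, ..., \<open>x n\<close> replace them and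
    \<open>x 0\<close> is added. Both readings give \<open>J'\<close>.\<close>
  define Jc where "Jc = (J - f ` {..<n}) \<union> x ` {..<n}"
  define Jd where "Jd = (J - f ` {..<n}) \<union> (\<lambda>i. x (Suc i)) ` {..<n}"
  define J' where "J' = insert g Jc"
  \<comment> \<open>In \<open>c\<close> the triangular condition holds along the reversed
    path.\<close>
  have rev: "(\<lambda>i. h (n - Suc i)) ` {..<n} = h ` {..<n}" for h :: "nat \<Rightarrow> 'a"
    by (auto simp: image_iff) (metis diff_Suc_less Suc_diff_Suc diff_diff_cancel less_imp_le_nat not_less0 gr0I lessThan_iff)
  have "indep c ((J - (\<lambda>i. f (n - Suc i)) ` {..<n}) \<union> (\<lambda>i. x (n - Suc i)) ` {..<n}) \<and>
    c ((J - (\<lambda>i. f (n - Suc i)) ` {..<n}) \<union> (\<lambda>i. x (n - Suc i)) ` {..<n}) = c J"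
    using f xc chord_c by (intro c.exchange_triangular J) auto
  then have Jc: "indep c Jc" "c Jc = c J" unfolding rev Jc_def by auto
  have "indep d Jd \<and> d Jd = d J"
    unfolding Jd_def using f chord_d by (intro d.exchange_triangular J) auto
  then have Jd: "indep d Jd" "d Jd = d J" by auto
  have "x ` {..<n} \<union> {x n} = {x 0} \<union> (\<lambda>i. x (Suc i)) ` {..<n}"
    by (metis (no_types) Un_insert_right atLeast0LessThan image_Suc_lessThan image_image image_insert insert_is_Un lessThan_Suc
        lessThan_Suc_eq_insert_0 sup_bot_right)
  then have J'_d: "J' = insert s Jd" unfolding J'_def Jc_def Jd_def using x by auto
  have sd: "s \<notin> d J" using sg(1) S by blast
  have indep': "indep c J'" "indep d J'"
    unfolding J'_def using c.indep_insert Jc sg(3) apply simp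
    unfolding J'_def[symmetric] J'_d using d.indep_insert Jd sd by simp
  have spans: "c J' = c (insert g J)" "d J' = d (insert s J)"
    using c.span_Un_cong[OF Jc(2), of "{g}"] d.span_Un_cong[OF Jd(2), of "{s}"]
    unfolding J'_d by (simp_all add: J'_def flip: J'_d)

  have "J' \<inter> B = J \<inter> B \<and> (\<forall>f0\<in>J \<inter> B. d J \<inter> d (J' - {f0}) \<subseteq> d (J - {f0}))"
    if B: "blocked c d J B" for B
  proof -
    \<comment> \<open>Once in \<open>B\<close> the path would stay there, but its end
      \<open>g\<close> is outside \<open>c J\<close>.\<close>
    have xB: "x i \<notin> B" if "i \<le> n" for i
    proof
      assume "x i \<in> B"
      have "x (i + k) \<in> B" if "i + k \<le> n" for k
        using that
      proof (induct k)
        case (Suc k)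
        then show ?case using link[of "i + k"] B by (auto simp: blocked_def)
      qed (use \<open>x i \<in> B\<close> in simp)
      from this[of "n - i"] show False using that x sg(3) B by (auto simp: blocked_def)
    qed
    have fB: "f i \<notin> B" if "i < n" for i
    proof
      assume "f i \<in> B"
      moreover have "?L (f i) (x (Suc i))"
        using f[OF that] J(1) by (auto simp: link_def indep_def intro!: bexI[of _ "f i"])
      ultimately show False using xB[of "Suc i"] that B by (auto simp: blocked_def)
    qed
    have "g \<notin> B" using xB[of n] x by simp
    then have eq: "J' \<inter> B = J \<inter> B" using xB fB unfolding J'_def Jc_def by auto
    \<comment> \<open>In \<open>d\<close> all exchanges happen outside \<open>B\<close>:
      \<open>A\<close> alone spans the \<open>x (Suc i)\<close>, so they leave the span of
      \<open>A\<close> unchanged.\<close>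
    define A where "A = J - B"
    define A' where "A' = (A - f ` {..<n}) \<union> (\<lambda>i. x (Suc i)) ` {..<n}"
    have A: "indep d A" "A \<subseteq> J" using J(2) d.indep_mono by (auto simp: A_def)
    have xA: "x (Suc i) \<in> d A" if "i < n" for i
      using f[OF that] xB[of "Suc i"] that blocked_spans(2)[OF J B] by (auto simp: A_def)
    have "x (Suc j) \<in> d (A - {f i})" if "i < j" "j < n" for i j
    proof -
      have "x (Suc j) \<in> d (A \<inter> (J - {f i}))"
        using d.span_Int[OF J(2) A(2) Diff_subset xA chord_d] that by blast
      moreover have "A \<inter> (J - {f i}) = A - {f i}" using A by blast
      ultimately show ?thesis by simp
    qed
    moreover have "x (Suc i) \<notin> d (A - {f i})" if "i < n" for i
      using f[OF that] d.mono[of "A - {f i}" "J - {f i}"] A(2) by blast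
    ultimately have dA': "d A' = d A"
      unfolding A'_def using d.exchange_triangular[OF A(1), of n f "\<lambda>i. x (Suc i)"] f fB xA
      by (auto simp: A_def)
    have "d J \<inter> d (J' - {f0}) \<subseteq> d (J - {f0})" if f0: "f0 \<in> J \<inter> B" for f0
    proof
      fix y assume y: "y \<in> d J \<inter> d (J' - {f0})"
      have "y \<in> d (Jd \<inter> (J' - {f0}))"
        using d.span_Int[OF indep'(2), of Jd "J' - {f0}" y] y Jd(2) J'_d by auto
      moreover have "Jd \<inter> (J' - {f0}) \<subseteq> A' \<union> (J \<inter> B - {f0})"
        unfolding Jd_def A'_def A_def by blast
      ultimately have "y \<in> d (A' \<union> (J \<inter> B - {f0}))" using d.monoD by meson
      also have "\<dots> = d (A \<union> (J \<inter> B - {f0}))" by (rule d.span_Un_cong[OF dA'])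
      finally show "y \<in> d (J - {f0})" by (rule d.monoD) (use f0 in \<open>auto simp: A_def\<close>)
    qed
    then show ?thesis using eq by blast
  qed
  then have "refines c d J J'"
    unfolding refines_def using indep' spans c.mono[of J "insert g J"] d.mono[of J "insert s J"] by auto
  then show ?thesis using that sg spans by blast
qed

text \<open>Given a hindrance \<open>W\<close>, \<open>V\<close> of the contracted pair, follow
  paths for \<open>V\<close> in \<open>c\<close> and \<open>?d\<close> from the elements that
  \<open>V\<close> does not \<open>?d\<close>-span. If they all stay in \<open>c V\<close>, the
  reachable set is a wave, and looseness makes \<open>z\<close> spanned. Otherwise augmenting
  \<open>V\<close> yields a basis that turns \<open>W\<close> into a wave of the original
  pair.\<close>

lemma loose_imp_unhindered_contr:
  assumes loose: "loose c d" and g: "g \<notin> c {}"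
  shows "unhindered (contr c {g}) (contr d {y})"
proof (rule ccontr)
  assume "\<not> ?thesis"
  then obtain W V z where W: "wave (contr c {g}) (contr d {y}) W V"
    and z: "z \<in> W" "z \<notin> contr d {y} (- W \<union> V)"
    by (auto simp: unhindered_def)
  let ?d = "contr d (- W)"
  interpret e: matroid_closure ?d by (rule d.contr_closure)
  interpret p: matroid_closure_pair c ?d by unfold_locales
  have V: "V \<subseteq> W" "W \<subseteq> c (insert g V)" "indep c V" "indep ?d V"
    using W c.indep_contr_sub[of "{g}" V "{}"] d.indep_contr_sub[of "{y} \<union> - W" V "- W"]
    by (auto simp: wave_def contr_contr) (auto simp: contr_def)
  have "z \<notin> d (- W \<union> V)" using z d.mono[of "- W \<union> V" "{y} \<union> (- W \<union> V)"] by (auto simp: contr_def)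
  then have zd: "z \<notin> ?d V" by (simp add: contr_def)
  define R where "R = reach c ?d V (- ?d V)"
  have R: "- ?d V \<subseteq> R" unfolding R_def by (rule p.subset_reach)
  show False
  proof (cases "R \<subseteq> c V")
    case True
    then have B: "blocked c ?d V R" unfolding R_def by (rule p.blocked_reach)
    note side = p.blocked_spans[OF V(3,4) B]
    \<comment> \<open>Everything outside \<open>R\<close> is spanned by \<open>- W\<close> and the
      part of \<open>V\<close> outside \<open>R\<close>. Hence contracting \<open>- R\<close>
      preserves the independence of \<open>V \<inter> R\<close>.\<close>
    have out: "- R \<subseteq> d (- W \<union> (V - R))" using side(2) R by (auto simp: contr_def)
    have "v \<notin> d (- R \<union> (V \<inter> R - {v}))" if v: "v \<in> V \<inter> R" for v
    proof
      assume *: "v \<in> d (- R \<union> (V \<inter> R - {v}))"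
      have "- R \<union> (V \<inter> R - {v}) \<subseteq> d (- W \<union> (V - {v}))"
        using out d.mono[of "- W \<union> (V - R)" "- W \<union> (V - {v})"] d.ext[of "- W \<union> (V - {v})"] v by blast
      then have "v \<in> d (- W \<union> (V - {v}))" using * d.span_subset by blast
      then show False using V(4) v by (auto simp: indep_def contr_def)
    qed
    then have "wave c d R (V \<inter> R)"
      using side(1) c.indep_mono[OF V(3)] by (auto simp: wave_def indep_def contr_def)
    then have "R \<subseteq> d (- R)" using loose by (auto simp: loose_def)
    moreover have "- R \<subseteq> d (- W \<union> V)" using out d.mono[of "- W \<union> (V - R)" "- W \<union> V"] by blast
    ultimately have "z \<in> d (- W \<union> V)" using R zd d.span_subset by blast
    then show False using zd by (simp add: contr_def)
  next
    case False
    have "- ?d V \<inter> ?d V = {}" by blast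
    from p.augment[OF V(3,4) this False[unfolded R_def]]
    obtain g' J' where J': "g' \<notin> c V" "refines c ?d V J'" "c J' = c (insert g' V)"
      by metis
    have J'W: "J' \<subseteq> W"
    proof
      fix x assume "x \<in> J'"
      then have "x \<notin> ?d {}" using J'(2) e.indep_loops by (auto simp: refines_def)
      then show "x \<in> W" using d.ext[of "- W"] by (auto simp: contr_def)
    qed
    have g': "g' \<in> c J'" using J'(3) c.ext[of "insert g' V"] by blast
    \<comment> \<open>\<open>J'\<close> stays within the span of \<open>V\<close> and
      \<open>g\<close> but exceeds that of \<open>V\<close>; by exchange it spans \<open>g\<close>,
      and therefore \<open>W\<close>.\<close>
    have "c J' \<subseteq> c (insert g V)" using J'W V(2) by (intro c.span_subset) blast
    then have "g \<in> c (insert g' V)" using c.exchange[of g' g V] J'(1) g' by blast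
    then have "insert g V \<subseteq> c J'" using J'(3) c.ext[of "insert g' V"] by blast
    then have "W \<subseteq> c J'" using V(2) c.span_subset by blast
    then have "wave c d W J'" using J'W J'(2) by (auto simp: wave_def refines_def)
    then have "W \<subseteq> c {}" using loose by (auto simp: loose_def)
    then have "c J' \<subseteq> c {}" using J'W by (intro c.span_subset) blast
    then show False using g' J'(1) c.mono[of "{}" V] by blast
  qed
qed

section \<open>Spanning a given element\<close>

definition nice :: "'a set \<Rightarrow> bool" where
  "nice J \<longleftrightarrow> indep c J \<and> indep d J \<and> loose (contr c J) (contr d J)"

lemma nice_augment:
  assumes J: "nice J" and S: "S \<inter> d J = {}" and R: "\<not> reach c d J S \<subseteq> c J"
  obtains s J' where "s \<in> S" "nice J'" "refines c d J J'" "s \<in> d J'"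
proof -
  obtain s g J1 where J1: "s \<in> S" "g \<notin> c J" "refines c d J J1"
      "c J1 = c (insert g J)" "d J1 = d (insert s J)"
    using augment[OF _ _ S R] J by (auto simp: nice_def)
  interpret p: matroid_closure_pair "contr c J" "contr d J"
    by (intro matroid_closure_pair.intro c.contr_closure d.contr_closure)
  interpret p1: matroid_closure_pair "contr c J1" "contr d J1"
    by (intro matroid_closure_pair.intro c.contr_closure d.contr_closure)
  have "unhindered (contr (contr c J) {g}) (contr (contr d J) {s})"
    using J J1(2) by (intro p.loose_imp_unhindered_contr) (auto simp: nice_def contr_def)
  \<comment> \<open>Contractions depend only on the span, so \<open>J1\<close> can stand for
    \<open>insert g J\<close> in \<open>c\<close> and for \<open>insert s J\<close> in
    \<open>d\<close>.\<close>
  then have "unhindered (contr c J1) (contr d J1)"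
    using c.contr_cong[OF J1(4)] d.contr_cong[OF J1(5)] by (simp add: contr_contr)
  then obtain V where V: "indep (contr c J1) V" "indep (contr d J1) V"
      "loose (contr (contr c J1) V) (contr (contr d J1) V)"
    by (rule p1.unhindered_imp_loose_contr)
  have indep: "indep c (J1 \<union> V)" "indep d (J1 \<union> V)"
    using J1(3) V c.indep_Un d.indep_Un by (auto simp: refines_def)
  then have "nice (J1 \<union> V)" using V(3) by (simp add: nice_def contr_contr)
  moreover have "refines c d J (J1 \<union> V)" using refines_extend[OF J1(3)] indep by blast
  moreover have "s \<in> d (J1 \<union> V)"
    using J1(5) d.ext[of "insert s J"] d.mono[of J1 "J1 \<union> V"] by blast
  ultimately show ?thesis using that J1(1) by blast
qed

definition step :: "'a set \<Rightarrow> 'a set \<Rightarrow> bool" where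
  "step J J' \<longleftrightarrow> nice J \<and> nice J' \<and> refines c d J J'"

definition final :: "'a set \<Rightarrow> 'a set \<Rightarrow> bool" where
  "final Q J \<longleftrightarrow> nice J \<and> (\<forall>J'. step\<^sup>*\<^sup>* J J' \<longrightarrow> d.rank_over J Q \<le> d.rank_over J' Q)"

definition front :: "'a set \<Rightarrow> 'a set \<Rightarrow> 'a set" where
  "front Q J = reach c d J (d (J \<union> Q) - d J)"

lemma steps_spans: "step\<^sup>*\<^sup>* J J' \<Longrightarrow> d J \<subseteq> d J'"
  by (induct rule: rtranclp_induct) (auto simp: step_def refines_def)

lemma final_exists:
  assumes "nice J"
  obtains J' where "step\<^sup>*\<^sup>* J J'" "final Q J'"
proof -
  obtain J' where J': "step\<^sup>*\<^sup>* J J'" "\<And>J''. step\<^sup>*\<^sup>* J J'' \<Longrightarrow> d.rank_over J' Q \<le> d.rank_over J'' Q"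
    using ex_has_least_nat[of "step\<^sup>*\<^sup>* J" J "\<lambda>J'. d.rank_over J' Q"] by blast
  have "nice J'" using J'(1) assms by (induct rule: rtranclp_induct) (auto simp: step_def)
  then have "final Q J'" using J' by (auto simp: final_def intro: rtranclp_trans)
  then show ?thesis using that J' by blast
qed

lemma final_step:
  assumes "finite Q" "final Q J" "step J J'"
  shows "final Q J'"
proof -
  have "d J \<subseteq> d J'" using assms(3) by (simp add: step_def refines_def)
  then have "d.rank_over J' Q \<le> d.rank_over J Q" by (rule d.rank_over_mono[OF assms(1)])
  then show ?thesis
    using assms(2,3) unfolding final_def step_def[of J J']
    by (meson assms(3) converse_rtranclp_into_rtranclp order_trans)
qed

text \<open>Otherwise an augmentation would span a starting point of the front and so lower the rank
  of \<open>Q\<close>.\<close>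

lemma final_front_blocked:
  assumes "finite Q" "final Q J"
  shows "front Q J \<subseteq> c J"
proof (rule ccontr)
  assume R: "\<not> front Q J \<subseteq> c J"
  have J: "nice J" using assms by (simp add: final_def)
  obtain s J' where J': "s \<in> d (J \<union> Q) - d J" "nice J'" "refines c d J J'" "s \<in> d J'"
    using nice_augment[OF J _ R[unfolded front_def]] by blast
  then have "d.rank_over J' Q < d.rank_over J Q"
    by (intro d.rank_over_less[OF assms(1)]) (auto simp: refines_def)
  moreover have "step\<^sup>*\<^sup>* J J'" using J J' by (auto simp: step_def)
  ultimately show False using assms(2) by (auto simp: final_def not_less[symmetric])
qed

text \<open>Starting points stay unspanned, since spanning one would lower the rank; the arcs
  persist by \<open>refines\<close>.\<close>

lemma front_step:
  assumes Q: "finite Q" and J: "final Q J" and step: "step J J'"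
  shows "front Q J \<subseteq> front Q J'" "J' \<inter> front Q J = J \<inter> front Q J"
proof -
  have nice: "indep c J" "indep d J" "refines c d J J'" using step by (auto simp: step_def nice_def)
  have "d (J \<union> Q) - d J \<subseteq> d (J' \<union> Q) - d J'"
  proof
    fix s assume s: "s \<in> d (J \<union> Q) - d J"
    have le: "d J \<subseteq> d J'" using nice by (simp add: refines_def)
    then have "s \<in> d (J' \<union> Q)" using s d.span_Un_mono[of J J' Q Q] by blast
    moreover have "d.rank_over J Q \<le> d.rank_over J' Q" using J step by (auto simp: final_def)
    then have "s \<notin> d J'" using d.rank_over_less[OF Q le, of s] s by force
    ultimately show "s \<in> d (J' \<union> Q) - d J'" by blast
  qed
  then show "front Q J \<subseteq> front Q J'" "J' \<inter> front Q J = J \<inter> front Q J"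
    unfolding front_def
    using reach_mono_refines[OF nice(1,2) final_front_blocked[OF Q J, unfolded front_def] nice(3)]
    by blast+
qed

lemma front_steps:
  assumes Q: "finite Q" and J: "final Q J" and steps: "step\<^sup>*\<^sup>* J J'"
  shows "final Q J' \<and> front Q J \<subseteq> front Q J' \<and> J' \<inter> front Q J = J \<inter> front Q J"
  using steps
proof (induct rule: rtranclp_induct)
  case (step J1 J2)
  then show ?case using front_step[OF Q, of J1 J2] final_step[OF Q, of J1 J2] by blast
qed (use J in simp)

lemma front_mono: "Q \<subseteq> Q' \<Longrightarrow> front Q J \<subseteq> front Q' J"
  using d.mono[of "J \<union> Q" "J \<union> Q'"] unfolding front_def reach_def by blast

section \<open>The limit of a sequence of augmentations\<close>

lemma loose_span_element:
  fixes e :: "nat \<Rightarrow> 'a"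
  assumes loose: "loose c d" and enum: "- range e \<subseteq> d {}"
  shows "\<exists>J. nice J \<and> x \<in> d J"
proof -
  have nice0: "nice {}" using loose by (simp add: nice_def)
  show ?thesis
  proof (rule ccontr)
    assume "\<not> ?thesis"
    then have bad: "x \<notin> d J" if "nice J" for J using that by blast
    \<comment> \<open>\<open>x\<close> is put into every \<open>Q k\<close>, which places it in the
      front from stage 0 on.\<close>
    define Q where "Q k = insert x (e ` {..k})" for k
    have Q: "finite (Q k)" "Q k \<subseteq> Q (Suc k)" for k by (auto simp: Q_def)
    have "\<exists>J. \<forall>k. final (Q k) (J k) \<and> step\<^sup>*\<^sup>* (J k) (J (Suc k))"
    proof (rule dependent_nat_choice)
      show "\<exists>J. final (Q 0) J" using final_exists[OF nice0] by blast
      show "\<exists>J'. final (Q (Suc k)) J' \<and> step\<^sup>*\<^sup>* J J'" if "final (Q k) J" for J k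
      proof -
        have "nice J" using that by (simp add: final_def)
        then show ?thesis using final_exists[of J "Q (Suc k)"] by blast
      qed
    qed
    then obtain J where final: "\<And>k. final (Q k) (J k)" and steps: "\<And>k. step\<^sup>*\<^sup>* (J k) (J (Suc k))"
      by blast
    have nice: "nice (J k)" "indep c (J k)" "indep d (J k)" for k
      using final by (auto simp: final_def nice_def)
    define B where "B k = front (Q k) (J k)" for k
    define V where "V k = J k \<inter> B k" for k
    have blocked: "blocked c d (J k) (B k)" for k
      using final_front_blocked[OF Q(1) final] unfolding B_def front_def by (rule blocked_reach)
    have B_Suc: "B k \<subseteq> B (Suc k)" "J (Suc k) \<inter> B k = J k \<inter> B k" for k
      using front_steps[OF Q(1) final steps, of k] front_mono[OF Q(2), of k "J (Suc k)"]
      unfolding B_def by blast+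
    then have V_Suc: "V k \<subseteq> V (Suc k)" for k unfolding V_def by blast
    have mono: "B m \<subseteq> B n" "V m \<subseteq> V n" "d (J m) \<subseteq> d (J n)" if "m \<le> n" for m n
      using lift_Suc_mono_le[of B m n] lift_Suc_mono_le[of V m n]
        lift_Suc_mono_le[of "\<lambda>k. d (J k)" m n] B_Suc V_Suc steps_spans[OF steps] that by blast+
    define U where "U = (\<Union>k. B k)"
    define V' where "V' = (\<Union>k. V k)"
    \<comment> \<open>Such a \<open>y\<close> is itself a starting point of the front.\<close>
    have unspanned: "y \<in> B m" if "y \<in> Q m" "y \<notin> d (J m)" for y m
      unfolding B_def front_def
      by (rule subsetD[OF subset_reach]) (use that d.ext[of "J m \<union> Q m"] in blast)
    have "x \<in> B 0" using unspanned[of x 0] bad[OF nice(1)] by (simp add: Q_def)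
    then have xU: "x \<in> U" by (auto simp: U_def)
    \<comment> \<open>An element outside \<open>U\<close> is spanned at all late stages, though perhaps by ever changing sets.\<close>
    have out: "\<exists>m\<ge>k. F \<subseteq> d (J m - B m)" if F: "finite F" "F \<subseteq> - U" for F k
    proof -
      have "\<exists>i. y \<in> d {} \<or> y = e i" for y using enum by blast
      then obtain i where i: "\<And>y. y \<in> d {} \<or> y = e (i y)" by metis
      \<comment> \<open>A stage not before \<open>k\<close> at which all of \<open>F\<close>, except
        possibly loops of \<open>d\<close>, has been enumerated.\<close>
      obtain m where m: "\<forall>j\<in>insert k (i ` F). j \<le> m" using finite_nat_set_iff_bounded_le F(1)
        by (metis finite_imageI finite_insert)
      have "y \<in> d (J m - B m)" if y: "y \<in> F" for y
      proof -
        have yB: "y \<notin> B m" using F(2) y by (auto simp: U_def)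
        have "y \<in> d (J m)"
        proof (cases "y \<in> d {}")
          case True
          then show ?thesis by (rule d.monoD) simp
        next
          case False
          then have "y \<in> Q m" using i[of y] m y by (auto simp: Q_def)
          then show ?thesis using unspanned yB by blast
        qed
        then show ?thesis using blocked_spans(2)[OF nice(2,3) blocked] yB by blast
      qed
      then show ?thesis using m by blast
    qed
    \<comment> \<open>Spanning has a finite witness \<open>F\<close>. At a late stage
      \<open>m\<close> its part in \<open>X\<close> lies in \<open>V m\<close> and the rest is
      spanned by \<open>J m - B m\<close>, so \<open>y\<close> would be spanned there too.\<close>
    have unspanned_out: "y \<notin> d (- U \<union> X)" if X: "X \<subseteq> V'" "\<And>k. k \<ge> k0 \<Longrightarrow> y \<notin> d ((J k - B k) \<union> (X \<inter> V k))" for y X k0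
    proof
      assume "y \<in> d (- U \<union> X)"
      from d.finitary[OF this] obtain F where F: "F \<subseteq> - U \<union> X" "finite F" "y \<in> d F" by blast
      have "\<forall>v\<in>F \<inter> X. \<exists>k. v \<in> V k" using X(1) by (auto simp: V'_def)
      then obtain i where i: "\<And>v. v \<in> F \<inter> X \<Longrightarrow> v \<in> V (i v)" by metis
      obtain k where k: "\<forall>j\<in>insert k0 (i ` (F \<inter> X)). j \<le> k" using finite_nat_set_iff_bounded_le F(2)
        by (metis finite_Int finite_imageI finite_insert)
      obtain m where m: "m \<ge> k" "F - X \<subseteq> d (J m - B m)" using out[of "F - X" k] F by blast
      have "v \<in> V m" if "v \<in> F \<inter> X" for v
        using i[OF that] mono(2)[of "i v" m] k m(1) that by (meson image_eqI insertCI order_trans subsetD)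
      then have "F \<subseteq> d ((J m - B m) \<union> (X \<inter> V m))"
        using m(2) d.mono[of "J m - B m" "(J m - B m) \<union> (X \<inter> V m)"]
          d.ext[of "(J m - B m) \<union> (X \<inter> V m)"] by blast
      then have "y \<in> d ((J m - B m) \<union> (X \<inter> V m))" using F(3) d.span_subset by blast
      moreover have "m \<ge> k0" using k m(1) by auto
      ultimately show False using X(2) by blast
    qed
    have "wave c d U V'"
      unfolding wave_def
    proof (intro conjI)
      show "V' \<subseteq> U" by (auto simp: U_def V'_def V_def)
      show "indep c V'" unfolding V'_def
      proof (rule c.indep_UN_mono)
        show "indep c (V k)" for k unfolding V_def by (rule c.indep_mono[OF nice(2)]) blast
      qed (rule V_Suc)
      show "U \<subseteq> c V'"
      proof
        fix y assume "y \<in> U"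
        then obtain k where "y \<in> B k" by (auto simp: U_def)
        then have "y \<in> c (V k)" using blocked_spans(1)[OF nice(2,3) blocked] by (auto simp: V_def)
        then show "y \<in> c V'" by (rule c.monoD) (auto simp: V'_def)
      qed
      show "indep (contr d (- U)) V'"
        unfolding indep_def contr_def
      proof
        fix v assume "v \<in> V'"
        then obtain k0 where k0: "v \<in> V k0" by (auto simp: V'_def)
        show "v \<notin> d (- U \<union> (V' - {v}))"
        proof (rule unspanned_out)
          show "v \<notin> d ((J k - B k) \<union> ((V' - {v}) \<inter> V k))" if "k \<ge> k0" for k
            using mono(2)[OF that] k0 by (intro d.indepD[OF nice(3), of v k]) (auto simp: V_def)
        qed blast
      qed
    qed
    then have "U \<subseteq> c {}" "U \<subseteq> d (- U)" using loose by (auto simp: loose_def)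
    moreover have "x \<notin> d (- U \<union> {})"
    proof (rule unspanned_out)
      show "x \<notin> d ((J k - B k) \<union> ({} \<inter> V k))" for k
        using bad[OF nice(1), of k] d.mono[of "J k - B k" "J k"] by auto
    qed auto
    ultimately show False using xU by auto
  qed
qed

section \<open>From loose pairs to arbitrary pairs\<close>

text \<open>Contracting a \<open>nice\<close> set leaves a loose pair, so \<open>e 0\<close>,
  \<open>e 1\<close>, ... can be spanned one after another; elements outside the range of
  \<open>e\<close> are loops of \<open>d\<close>.\<close>

lemma loose_common_base:
  fixes e :: "nat \<Rightarrow> 'a"
  assumes loose: "loose c d" and enum: "- range e \<subseteq> d {}"
  obtains I where "indep c I" "indep d I" "d I = UNIV"
proof -
  have extend: "\<exists>J'. nice J' \<and> J \<subseteq> J' \<and> x \<in> d J'" if J: "nice J" for J x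
  proof -
    interpret p: matroid_closure_pair "contr c J" "contr d J"
      by (intro matroid_closure_pair.intro c.contr_closure d.contr_closure)
    have "- range e \<subseteq> contr d J {}" using enum d.mono[of "{}" J] by (auto simp: contr_def)
    then obtain K where K: "p.nice K" "x \<in> contr d J K"
      using p.loose_span_element[of e x] J by (auto simp: nice_def)
    then have "nice (J \<union> K)"
      using J c.indep_Un d.indep_Un by (auto simp: nice_def p.nice_def contr_contr)
    then show ?thesis using K(2) by (auto simp: contr_def)
  qed
  have "\<exists>J. \<forall>k. nice (J k) \<and> (J k \<subseteq> J (Suc k) \<and> e k \<in> d (J (Suc k)))"
  proof (rule dependent_nat_choice)
    show "\<exists>J. nice J" using loose by (auto simp: nice_def intro!: exI[of _ "{}"])
  qed (use extend in blast)
  then obtain J where nice: "\<And>k. nice (J k)" and sub: "\<And>k. J k \<subseteq> J (Suc k)"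
    and e: "\<And>k. e k \<in> d (J (Suc k))" by blast
  have "indep c (\<Union>k. J k)" using nice sub by (intro c.indep_UN_mono) (auto simp: nice_def)
  moreover have "indep d (\<Union>k. J k)" using nice sub by (intro d.indep_UN_mono) (auto simp: nice_def)
  moreover have "x \<in> d (\<Union>k. J k)" for x
  proof (cases "x \<in> d {}")
    case True
    then show ?thesis by (rule d.monoD) simp
  next
    case False
    then obtain k where "x = e k" using enum by blast
    moreover have "d (J (Suc k)) \<subseteq> d (\<Union>k. J k)" by (rule d.mono) blast
    ultimately show ?thesis using e[of k] by blast
  qed
  ultimately show ?thesis using that by blast
qed

text \<open>A maximal wave \<open>W\<close> with basis \<open>V\<close> provides the part spanned in
  \<open>c\<close>. What remains, with \<open>V\<close> contracted in \<open>c\<close> and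
  \<open>W\<close> deleted from \<open>d\<close>, is loose and has a \<open>c\<close>-independent
  base \<open>I\<close> of \<open>d\<close>; the answer is \<open>V \<union> I\<close>.\<close>

lemma intersection_closure:
  fixes e :: "nat \<Rightarrow> 'a"
  assumes enum: "- range e \<subseteq> d {}"
  obtains I U where "indep c I" "indep d I" "U \<subseteq> c (I \<inter> U)" "- U \<subseteq> d (I - U)"
proof -
  obtain W V where W: "wave c d W V"
    and max: "\<And>W' V'. wave c d W' V' \<Longrightarrow> W \<subseteq> W' \<Longrightarrow> V \<subseteq> V' \<Longrightarrow> W' = W \<and> V' = V"
    using maximal_wave by blast
  have V: "V \<subseteq> W" "W \<subseteq> c V" "indep c V" "indep (contr d (- W)) V"
    using W by (auto simp: wave_def)
  interpret p: matroid_closure_pair "contr c V" "del d W"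
    by (intro matroid_closure_pair.intro c.contr_closure d.del_closure)
  have "loose (contr c V) (del d W)"
    unfolding loose_def
  proof (intro allI impI)
    fix W' V' assume "wave (contr c V) (del d W) W' V'"
    then have W': "V' \<subseteq> W'" "indep (contr c V) V'" "W' \<subseteq> c (V \<union> V')"
        "indep (contr (del d W) (- W')) V'"
      by (auto simp: wave_def contr_def)
    have "indep (contr d (- (W \<union> W'))) V'"
      unfolding indep_def contr_def
    proof
      fix v assume v: "v \<in> V'"
      then have "v \<notin> d (- W' \<union> (V' - {v}) - W)" using W'(4) by (auto simp: indep_def contr_def del_def)
      \<comment> \<open>\<open>W\<close> consists of loops of \<open>c\<close> contracted by
        \<open>V\<close>, so \<open>V'\<close> avoids it. Deleting \<open>W\<close> thus only takes
        it out of the contracted set.\<close>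
      moreover have "V' \<inter> W = {}" using c.indep_contr_disjoint[OF W'(2)] V(2) by blast
      then have "- (W \<union> W') \<union> (V' - {v}) = - W' \<union> (V' - {v}) - W" by blast
      ultimately show "v \<notin> d (- (W \<union> W') \<union> (V' - {v}))" by simp
    qed
    then have "wave c d (W \<union> W') (V \<union> V')" using wave_extend[OF W W'(1-3)] by blast
    then have "W' \<subseteq> W" using max[of "W \<union> W'" "V \<union> V'"] by blast
    then show "W' \<subseteq> contr c V {} \<and> W' \<subseteq> del d W (- W')" using V(2) by (auto simp: contr_def del_def)
  qed
  moreover have "- range e \<subseteq> del d W {}" using enum by (auto simp: del_def)
  ultimately obtain I where I: "indep (contr c V) I" "indep (del d W) I" "del d W I = UNIV"
    by (rule p.loose_common_base)
  have IW: "I \<inter> W = {}" using c.indep_contr_disjoint[OF I(1)] V(2) by blast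
  have "indep d I"
    unfolding indep_def
  proof
    fix x assume x: "x \<in> I"
    then have "x \<notin> d (I - {x} - W)" using I(2) by (auto simp: indep_def del_def)
    moreover have "I - {x} - W = I - {x}" using IW by blast
    ultimately show "x \<notin> d (I - {x})" by simp
  qed
  \<comment> \<open>\<open>V\<close> is independent over all of \<open>- W\<close>, in particular
    over \<open>I\<close>.\<close>
  moreover have "indep (contr d I) V" using d.indep_contr_sub[OF V(4), of I] IW by blast
  ultimately have "indep d (I \<union> V)" by (rule d.indep_Un)
  moreover have "indep c (V \<union> I)" using c.indep_Un V(3) I(1) by blast
  moreover have "(V \<union> I) \<inter> W = V" "(V \<union> I) - W = I - W" using V(1) IW by auto
  moreover have "- W \<subseteq> d (I - W)" using I(3) by (auto simp: del_def)
  ultimately show ?thesis using that[of "V \<union> I" W] V(2) by (simp add: Un_commute)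
qed

end

section \<open>The closure operator of a finitary matroid\<close>

context finitary_matroid
begin

text \<open>Elements outside \<open>E\<close> become loops, so that two matroids on \<open>E\<close> give closure operators on the
  whole type.\<close>

definition span :: "'a set \<Rightarrow> 'a set" where
  "span X = {x. x \<notin> E \<or> x \<in> X \<or> (\<exists>F. finite F \<and> F \<subseteq> X \<and> F \<in> \<I> \<and> insert x F \<notin> \<I>)}"

text \<open>The axiom treats a difference of one; a subset of \<open>A\<close> with
  \<open>card B + 1\<close> elements reduces to it.\<close>

lemma augment_card:
  assumes "A \<in> \<I>" "B \<in> \<I>" "finite A" "finite B" "card B < card A"
  obtains e where "e \<in> A - B" "insert e B \<in> \<I>"
proof -
  obtain A' where A': "A' \<subseteq> A" "card A' = Suc (card B)"
    using obtain_subset_with_card_n[of "Suc (card B)" A] assms(5) by auto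
  then have "A' \<in> \<I>" "finite A'" using assms indep_subset finite_subset by blast+
  then obtain e where "e \<in> A' - B" "insert e B \<in> \<I>"
    using indep_augment[of B A'] assms A'(2) by auto
  then show ?thesis using that A' by blast
qed

lemma maximal_indep_extension:
  assumes "finite X" "F \<subseteq> X" "F \<in> \<I>"
  obtains B where "F \<subseteq> B" "B \<subseteq> X" "B \<in> \<I>" "finite B" "\<And>x. x \<in> X - B \<Longrightarrow> insert x B \<notin> \<I>"
proof -
  let ?\<B> = "{B. F \<subseteq> B \<and> B \<subseteq> X \<and> B \<in> \<I>}"
  have "finite ?\<B>" by (rule finite_subset[of _ "Pow X"]) (use assms(1) in auto)
  moreover have "F \<in> ?\<B>" using assms by simp
  ultimately obtain B where B: "B \<in> ?\<B>" "\<forall>B'\<in>?\<B>. B \<subseteq> B' \<longrightarrow> B = B'"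
    by (meson finite_has_maximal2)
  show ?thesis
  proof (rule that[of B])
    show "insert x B \<notin> \<I>" if "x \<in> X - B" for x using B that by blast
    show "finite B" using B(1) assms(1) by (auto intro: finite_subset)
  qed (use B in auto)
qed

lemma card_le_maximal:
  assumes "A \<in> \<I>" "B \<in> \<I>" "finite A" "finite B" "\<And>x. x \<in> A - B \<Longrightarrow> insert x B \<notin> \<I>"
  shows "card A \<le> card B"
  using augment_card[OF assms(1-4)] assms(5) by (metis not_le)

text \<open>Otherwise extend \<open>F\<close> to a maximal independent \<open>B'\<close> within
  \<open>B \<union> F\<close>. It is no larger than \<open>B\<close>, so \<open>insert y B\<close>
  augments it: by \<open>y\<close>, against the dependence of \<open>insert y F\<close>, or by an
  element of \<open>B\<close>, against maximality.\<close>

lemma maximal_spans: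
  assumes B: "B \<in> \<I>" "finite B" and F: "F \<in> \<I>" "finite F" "insert y F \<notin> \<I>"
    and max: "\<And>z. z \<in> F - B \<Longrightarrow> insert z B \<notin> \<I>" and y: "y \<notin> B"
  shows "insert y B \<notin> \<I>"
proof
  assume yB: "insert y B \<in> \<I>"
  obtain B' where B': "F \<subseteq> B'" "B' \<subseteq> B \<union> F" "B' \<in> \<I>" "finite B'"
      "\<And>x. x \<in> B \<union> F - B' \<Longrightarrow> insert x B' \<notin> \<I>"
    using maximal_indep_extension[of "B \<union> F" F] B F by blast
  have "card B' \<le> card B" by (rule card_le_maximal) (use B B' max in auto)
  then have "card B' < card (insert y B)" using B y by simp
  then obtain e where e: "e \<in> insert y B - B'" "insert e B' \<in> \<I>"
    using augment_card[OF yB B'(3)] B(2) B'(4) by auto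
  show False
  proof (cases "e = y")
    case True
    then show False using e F(3) B'(1) indep_subset[of "insert e B'" "insert y F"] by blast
  next
    case False
    then show False using e B'(5) by blast
  qed
qed

text \<open>The finite witnesses for the elements of \<open>F\<close> are pooled in
  \<open>X0\<close>. A maximal independent subset \<open>B\<close> of \<open>X0\<close> replaces
  them all: by \<open>maximal_spans\<close> it spans first \<open>F\<close> and then
  \<open>y\<close>.\<close>

lemma span_idem: "span (span X) \<subseteq> span X"
proof
  fix y assume y: "y \<in> span (span X)"
  show "y \<in> span X"
  proof (rule ccontr)
    assume ny: "y \<notin> span X"
    then have yX: "y \<in> E" "y \<notin> X" "\<And>F. finite F \<Longrightarrow> F \<subseteq> X \<Longrightarrow> F \<in> \<I> \<Longrightarrow> insert y F \<in> \<I>"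
      by (auto simp: span_def)
    obtain F where F: "finite F" "F \<subseteq> span X" "F \<in> \<I>" "insert y F \<notin> \<I>"
      using y ny yX(1) unfolding span_def[of "span X"] by auto
    have "\<exists>G. finite G \<and> G \<subseteq> X \<and> (z \<in> G \<or> G \<in> \<I> \<and> insert z G \<notin> \<I>)" if "z \<in> F" for z
    proof -
      have "z \<in> E" "z \<in> span X" using that F indep_carrier by blast+
      then show ?thesis by (cases "z \<in> X") (auto simp: span_def intro: exI[of _ "{z}"])
    qed
    then obtain G where G: "\<And>z. z \<in> F \<Longrightarrow> finite (G z) \<and> G z \<subseteq> X \<and> (z \<in> G z \<or> G z \<in> \<I> \<and> insert z (G z) \<notin> \<I>)"
      by metis
    define X0 where "X0 = (\<Union>z\<in>F. G z)"
    have X0: "finite X0" "X0 \<subseteq> X" using G F(1) by (auto simp: X0_def)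
    from maximal_indep_extension[OF X0(1) empty_subsetI indep_empty]
    obtain B where B: "B \<subseteq> X0" "B \<in> \<I>" "finite B" "\<And>x. x \<in> X0 - B \<Longrightarrow> insert x B \<notin> \<I>"
      by metis
    have B_max: "insert z B \<notin> \<I>" if z: "z \<in> F - B" for z
    proof (cases "z \<in> G z")
      case True
      then show ?thesis using B(4)[of z] z by (auto simp: X0_def)
    next
      case False
      have "G z \<subseteq> X0" using z by (auto simp: X0_def)
      then have "insert w B \<notin> \<I>" if "w \<in> G z - B" for w using that B(4)[of w] by blast
      moreover have "G z \<in> \<I>" "finite (G z)" "insert z (G z) \<notin> \<I>" "z \<notin> B"
        using G[of z] False z by auto
      ultimately show ?thesis using maximal_spans[OF B(2,3)] by metis
    qed
    have "y \<notin> B" "B \<subseteq> X" using B(1) X0(2) yX(2) by auto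
    then have "insert y B \<notin> \<I>" using maximal_spans[OF B(2,3) F(3,1,4) B_max] by metis
    then show False using yX(3)[OF B(3) \<open>B \<subseteq> X\<close> B(2)] by simp
  qed
qed

lemma span_closure: "matroid_closure span"
proof
  fix X Y :: "'a set" and x y
  show "X \<subseteq> span X" by (auto simp: span_def)
  show "X \<subseteq> Y \<Longrightarrow> span X \<subseteq> span Y" unfolding span_def by blast
  show "span (span X) \<subseteq> span X" by (rule span_idem)
  show "\<exists>F\<subseteq>X. finite F \<and> x \<in> span F" if x: "x \<in> span X"
  proof -
    consider "x \<notin> E" | "x \<in> X" | F where "finite F" "F \<subseteq> X" "F \<in> \<I>" "insert x F \<notin> \<I>"
      using x by (auto simp: span_def)
    then show ?thesis
    proof cases
      case 1
      then show ?thesis by (intro exI[of _ "{}"]) (auto simp: span_def)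
    next
      case 2
      then show ?thesis by (intro exI[of _ "{x}"]) (auto simp: span_def)
    next
      case (3 F)
      then show ?thesis by (intro exI[of _ F]) (auto simp: span_def)
    qed
  qed
  show "x \<in> span (insert y X)" if y: "y \<in> span (insert x X)" "y \<notin> span X" for x y
  proof (cases "x = y")
    case False
    have yX: "y \<in> E" "y \<notin> X" "\<And>F. finite F \<Longrightarrow> F \<subseteq> X \<Longrightarrow> F \<in> \<I> \<Longrightarrow> insert y F \<in> \<I>"
      using y(2) by (auto simp: span_def)
    then obtain F where F: "finite F" "F \<subseteq> insert x X" "F \<in> \<I>" "insert y F \<notin> \<I>"
      using y(1) False by (auto simp: span_def)
    then have xF: "x \<in> F" using yX(3)[of F] by blast
    \<comment> \<open>Independent because \<open>X\<close> does not span \<open>y\<close>; adding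
      \<open>x\<close> gives back the dependent set \<open>insert y F\<close>.\<close>
    have F': "finite (insert y (F - {x}))" "insert y (F - {x}) \<subseteq> insert y X" "insert y (F - {x}) \<in> \<I>"
      using F yX(3)[of "F - {x}"] indep_subset[OF F(3), of "F - {x}"] by auto
    have "insert x (insert y (F - {x})) = insert y F" using xF by blast
    then have "insert x (insert y (F - {x})) \<notin> \<I>" using F(4) by simp
    then show ?thesis using F' unfolding span_def by blast
  qed (simp add: span_def)
qed

lemma indep_span_iff: "indep span X \<longleftrightarrow> X \<in> \<I>"
proof
  assume X: "indep span X"
  have "X \<subseteq> E" using X by (auto simp: indep_def span_def)
  then show "X \<in> \<I>"
  proof (rule indep_finitary)
    fix F assume "F \<subseteq> X" "finite F"
    from this(2,1) show "F \<in> \<I>"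
    proof induct
      case (insert x F)
      then show ?case using X unfolding indep_def span_def by blast
    qed (rule indep_empty)
  qed
next
  assume X: "X \<in> \<I>"
  show "indep span X"
    unfolding indep_def
  proof
    fix x assume x: "x \<in> X"
    have "insert x F \<in> \<I>" if "F \<subseteq> X - {x}" for F using indep_subset[OF X] that x by blast
    then show "x \<notin> span (X - {x})" using indep_carrier[OF X] x by (auto simp: span_def)
  qed
qed

text \<open>A minimal dependent subset of \<open>insert x F\<close> is a circuit, and it contains
  \<open>x\<close> because \<open>F\<close> is independent.\<close>

lemma spans_elem_if_span:
  assumes "x \<in> span X" "x \<in> E"
  shows "spans_elem E \<I> X x"
proof (cases "x \<in> X")
  case False
  then obtain F where F: "finite F" "F \<subseteq> X" "F \<in> \<I>" "insert x F \<notin> \<I>"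
    using assms by (auto simp: span_def)
  let ?\<D> = "{D. D \<subseteq> insert x F \<and> D \<notin> \<I>}"
  have "finite ?\<D>" by (rule finite_subset[of _ "Pow (insert x F)"]) (use F(1) in auto)
  moreover have "insert x F \<in> ?\<D>" using F(4) by simp
  ultimately obtain C where C: "C \<in> ?\<D>" "\<forall>D\<in>?\<D>. D \<subseteq> C \<longrightarrow> C = D"
    by (meson finite_has_minimal2)
  have "C \<subseteq> E" using C(1) assms(2) indep_carrier[OF F(3)] by blast
  then have "circuit E \<I> C" using C unfolding circuit_def dependent_def by blast
  moreover have "x \<in> C" using C(1) indep_subset[OF F(3), of C] by blast
  moreover have "C - {x} \<subseteq> X" using C(1) F(2) by blast
  ultimately show ?thesis by (auto simp: spans_elem_def)
qed (simp add: spans_elem_def)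

end

theorem theorem1p3:
  fixes E :: "'a set" and \<M> \<N> :: "'a set set"
  assumes "countable E"
    and "finitary_matroid E \<M>"
    and "finitary_matroid E \<N>"
  shows "intersection_property E \<M> \<N>"
proof -
  interpret m: finitary_matroid E \<M> by fact
  interpret n: finitary_matroid E \<N> by fact
  interpret matroid_closure_pair m.span n.span
    by (intro matroid_closure_pair.intro m.span_closure n.span_closure)
  obtain e :: "nat \<Rightarrow> 'a" where "E \<subseteq> range e"
    using subset_range_from_nat_into[OF assms(1)] by blast
  \<comment> \<open>Elements outside \<open>E\<close> are loops, so a sequence covering
    \<open>E\<close> suffices.\<close>
  then have "- range e \<subseteq> n.span {}" by (auto simp: n.span_def)
  then obtain I U where I: "indep m.span I" "indep n.span I"
      and U: "U \<subseteq> m.span (I \<inter> U)" "- U \<subseteq> n.span (I - U)"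
    by (rule intersection_closure)
  have I: "I \<in> \<M>" "I \<in> \<N>" using I m.indep_span_iff n.indep_span_iff by auto
  then have "I \<subseteq> E" using m.indep_carrier by blast
  \<comment> \<open>\<open>U\<close> may contain elements outside \<open>E\<close>; cutting it down
    to \<open>E\<close> loses nothing of \<open>I\<close>.\<close>
  then have eq: "I \<inter> (E \<inter> U) = I \<inter> U" "I \<inter> (E - U) = I - U" by auto
  have "spans E \<M> (I \<inter> (E \<inter> U)) (E \<inter> U)" "spans E \<N> (I \<inter> (E - U)) (E - U)"
    unfolding eq spans_def using U by (auto intro!: m.spans_elem_if_span n.spans_elem_if_span)
  moreover have "E = (E \<inter> U) \<union> (E - U)" "(E \<inter> U) \<inter> (E - U) = {}" by auto
  ultimately show ?thesis unfolding intersection_property_def using I by blast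
qed

end
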